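(* Let $\mathscr{A}$ be a locally small, well-powered and well-copowered category equipped with a proper factorisation system $(\mathscr{Q},\mathscr{M})$, and suppose that $\mathscr{A}$ is $\mathscr{Q}$-well-founded. Let $F,G\colon \mathscr{A}^{\mathrm{op}}\to\mathbf{FinSet}$ be polyadic finite sets on $\mathscr{A}$. If $F$ and $G$ are pointwise isomorphic (i.e. $F(n)\cong G(n)$ for every object $n\in\mathscr{A}$), then their Stirling kernels $F^{\bullet}$ and $G^{\bullet}$ are pointwise isomorphic (i.e. $F^{\bullet}(n)\cong G^{\bullet}(n)$ for every object $n\in\mathscr{A}$).
   Context: A proper factorisation system on a category $\mathscr{A}$ is a pair $(\mathscr{Q},\mathscr{M})$ of classes of morphisms such that: every morphism $f$ factors as $f=m\circ e$ with $e\in\mathscr{Q}$, $m\in\mathscr{M}$; $\mathscr{Q}$ is exactly the class of morphisms with the left lifting property with respect to all morphisms of $\mathscr{M}$, and $\mathscr{M}$ is exactly the class of morphisms with the right lifting property with respect to all morphisms of $\mathscr{Q}$ (fillers not required to be unique); every morphism in $\mathscr{Q}$ is an epimorphism and every morphism in $\mathscr{M}$ is a monomorphism. Morphisms in $\mathscr{Q}$ are called quotients, those in $\mathscr{M}$ embeddings; a proper quotient is a quotient that is not an isomorphism. For an object $a$, $\mathscr{Q}(a)$ is the poset of quotients with domain $a$, where $f\leq g$ iff $f=h\circ g$ for some morphism $h$, modulo the equivalence relation identifying $f$ and $g$ when $f\leq g$ and $g\leq f$. $\mathscr{A}$ is $\mathscr{Q}$-well-founded if for every object $a$ each non-empty subset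 of $\mathscr{Q}(a)$ has a minimal element. A functor $F\colon\mathscr{A}^{\mathrm{op}}\to\mathbf{Set}$ has the amalgamation property if for all morphisms $f\colon d\to a$, $g\colon d\to b$ and all $x\in F(a)$, $y\in F(b)$ with $F(f)(x)=F(g)(y)$, there are morphisms $g'\colon a\to c$, $f'\colon b\to c$ with $g'\circ f=f'\circ g$ and $z\in F(c)$ with $F(g')(z)=x$ and $F(f')(z)=y$. A polyadic set on $\mathscr{A}$ is a functor $\mathscr{A}^{\mathrm{op}}\to\mathbf{Set}$ with the amalgamation property; it is a polyadic finite set if all its values are finite sets. For a polyadic set $F$, an element $x\in F(n)$ is degenerate if there are a proper quotient $f\colon n\to m$ and $y\in F(m)$ with $F(f)(y)=x$; otherwise it is generic. $F^{\bullet}(n)\subseteq F(n)$ is the set of generic elements. The Stirling kernel of $F$ is the assignment $n\mapsto F^{\bullet}(n)$, a functor $\mathscr{A}_*^{\mathrm{op}}\to\mathbf{Set}$ where $\mathscr{A}_*$ is the category with the same objects as $\mathscr{A}$ and with morphisms the embeddings. *)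

theory Defs
  imports "HOL-Library.Equipollence"
begin

section \<open>Categories\<close>

record ('o, 'm) cat =
  Obj :: "'o set"
  Arr :: "'m set"
  Dom :: "'m \<Rightarrow> 'o"
  Cod :: "'m \<Rightarrow> 'o"
  Ide :: "'o \<Rightarrow> 'm"
  Comp :: "'m \<Rightarrow> 'm \<Rightarrow> 'm" (infixr "\<cdot>\<index>" 70)

definition hom :: "('o, 'm) cat \<Rightarrow> 'o \<Rightarrow> 'o \<Rightarrow> 'm set" where
  "hom A a b = {f \<in> Arr A. Dom A f = a \<and> Cod A f = b}"

locale category =
  fixes A :: "('o, 'm) cat" (structure)
  assumes Dom_in_Obj: "f \<in> Arr A \<Longrightarrow> Dom A f \<in> Obj A"
    and Cod_in_Obj: "f \<in> Arr A \<Longrightarrow> Cod A f \<in> Obj A"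
    and Ide_in_hom: "a \<in> Obj A \<Longrightarrow> Ide A a \<in> hom A a a"
    and Comp_in_hom: "f \<in> hom A a b \<Longrightarrow> g \<in> hom A b c \<Longrightarrow> g \<cdot> f \<in> hom A a c"
    and Comp_Ide: "f \<in> hom A a b \<Longrightarrow> f \<cdot> Ide A a = f"
    and Ide_Comp: "f \<in> hom A a b \<Longrightarrow> Ide A b \<cdot> f = f"
    and Comp_assoc: "f \<in> hom A a b \<Longrightarrow> g \<in> hom A b c \<Longrightarrow> h \<in> hom A c d \<Longrightarrow>
      (h \<cdot> g) \<cdot> f = h \<cdot> (g \<cdot> f)"

definition is_iso :: "('o, 'm) cat \<Rightarrow> 'm \<Rightarrow> bool" where
  "is_iso A f \<longleftrightarrow> f \<in> Arr A \<and>
     (\<exists>g \<in> hom A (Cod A f) (Dom A f).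
        g \<cdot>\<^bsub>A\<^esub> f = Ide A (Dom A f) \<and> f \<cdot>\<^bsub>A\<^esub> g = Ide A (Cod A f))"

definition is_mono :: "('o, 'm) cat \<Rightarrow> 'm \<Rightarrow> bool" where
  "is_mono A f \<longleftrightarrow> f \<in> Arr A \<and>
     (\<forall>c. \<forall>g \<in> hom A c (Dom A f). \<forall>h \<in> hom A c (Dom A f).
        f \<cdot>\<^bsub>A\<^esub> g = f \<cdot>\<^bsub>A\<^esub> h \<longrightarrow> g = h)"

definition is_epi :: "('o, 'm) cat \<Rightarrow> 'm \<Rightarrow> bool" where
  "is_epi A f \<longleftrightarrow> f \<in> Arr A \<and>
     (\<forall>c. \<forall>g \<in> hom A (Cod A f) c. \<forall>h \<in> hom A (Cod A f) c.
        g \<cdot>\<^bsub>A\<^esub> f = h \<cdot>\<^bsub>A\<^esub> f \<longrightarrow> g = h)"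


section \<open>Subobjects, quotients and smallness\<close>

text \<open>\<open>sub_le\<close> compares arrows with a common codomain, \<open>quot_le\<close> arrows with a common domain.\<close>

definition sub_le :: "('o, 'm) cat \<Rightarrow> 'm \<Rightarrow> 'm \<Rightarrow> bool" where
  "sub_le A f g \<longleftrightarrow> (\<exists>h \<in> hom A (Dom A f) (Dom A g). f = g \<cdot>\<^bsub>A\<^esub> h)"

definition quot_le :: "('o, 'm) cat \<Rightarrow> 'm \<Rightarrow> 'm \<Rightarrow> bool" where
  "quot_le A f g \<longleftrightarrow> (\<exists>h \<in> hom A (Cod A g) (Cod A f). f = h \<cdot>\<^bsub>A\<^esub> g)"

definition order_equiv :: "('m \<Rightarrow> 'm \<Rightarrow> bool) \<Rightarrow> 'm set \<Rightarrow> ('m \<times> 'm) set" where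
  "order_equiv le S = {(f, g). f \<in> S \<and> g \<in> S \<and> le f g \<and> le g f}"

definition subobjects_by :: "('o, 'm) cat \<Rightarrow> 'm set \<Rightarrow> 'o \<Rightarrow> 'm set set" where
  "subobjects_by A N a =
     (let S = {f \<in> N. Cod A f = a} in S // order_equiv (sub_le A) S)"

definition quotients_by :: "('o, 'm) cat \<Rightarrow> 'm set \<Rightarrow> 'o \<Rightarrow> 'm set set" where
  "quotients_by A E a =
     (let S = {f \<in> E. Dom A f = a} in S // order_equiv (quot_le A) S)"

text \<open>
  The types of objects and arrows may be of any size, so sizes are measured against a
  universe \<open>U\<close>: a collection is small if its cardinality is strictly below that of \<open>U\<close>.
  When \<open>U\<close> is a Grothendieck universe, these are exactly the collections in bijection with
  an element of \<open>U\<close>.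
\<close>

definition locally_small :: "'u set \<Rightarrow> ('o, 'm) cat \<Rightarrow> bool" where
  "locally_small U A \<longleftrightarrow> (\<forall>a \<in> Obj A. \<forall>b \<in> Obj A. hom A a b \<prec> U)"

definition well_powered :: "'u set \<Rightarrow> ('o, 'm) cat \<Rightarrow> bool" where
  "well_powered U A \<longleftrightarrow> (\<forall>a \<in> Obj A. subobjects_by A {f. is_mono A f} a \<prec> U)"

definition well_copowered :: "'u set \<Rightarrow> ('o, 'm) cat \<Rightarrow> bool" where
  "well_copowered U A \<longleftrightarrow> (\<forall>a \<in> Obj A. quotients_by A {f. is_epi A f} a \<prec> U)"


section \<open>Proper factorisation systems\<close>

definition lifts_against :: "('o, 'm) cat \<Rightarrow> 'm \<Rightarrow> 'm \<Rightarrow> bool" where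
  "lifts_against A e m \<longleftrightarrow>
     (\<forall>u \<in> hom A (Dom A e) (Dom A m). \<forall>v \<in> hom A (Cod A e) (Cod A m).
        m \<cdot>\<^bsub>A\<^esub> u = v \<cdot>\<^bsub>A\<^esub> e \<longrightarrow>
        (\<exists>d \<in> hom A (Cod A e) (Dom A m). d \<cdot>\<^bsub>A\<^esub> e = u \<and> m \<cdot>\<^bsub>A\<^esub> d = v))"

locale proper_factorisation_system = category A
  for A :: "('o, 'm) cat" (structure) +
  fixes Q M :: "'m set"
  assumes factorisation: "f \<in> Arr A \<Longrightarrow>
      \<exists>e \<in> Q. \<exists>m \<in> M. Dom A e = Dom A f \<and> Cod A e = Dom A m \<and> Cod A m = Cod A f \<and> f = m \<cdot> e"
    and Q_eq: "Q = {e \<in> Arr A. \<forall>m \<in> M. lifts_against A e m}"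
    and M_eq: "M = {m \<in> Arr A. \<forall>e \<in> Q. lifts_against A e m}"
    and Q_epi: "e \<in> Q \<Longrightarrow> is_epi A e"
    and M_mono: "m \<in> M \<Longrightarrow> is_mono A m"

definition proper_quotient :: "('o, 'm) cat \<Rightarrow> 'm set \<Rightarrow> 'm \<Rightarrow> bool" where
  "proper_quotient A Q f \<longleftrightarrow> f \<in> Q \<and> \<not> is_iso A f"

definition quot_class_le :: "('o, 'm) cat \<Rightarrow> 'm set \<Rightarrow> 'm set \<Rightarrow> bool" where
  "quot_class_le A X Y \<longleftrightarrow> (\<exists>f \<in> X. \<exists>g \<in> Y. quot_le A f g)"

definition quotient_well_founded :: "('o, 'm) cat \<Rightarrow> 'm set \<Rightarrow> bool" where
  "quotient_well_founded A Q \<longleftrightarrow>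
     (\<forall>a \<in> Obj A. \<forall>S \<subseteq> quotients_by A Q a. S \<noteq> {} \<longrightarrow>
        (\<exists>X \<in> S. \<forall>Y \<in> S. quot_class_le A Y X \<longrightarrow> Y = X))"

definition embedding_category :: "('o, 'm) cat \<Rightarrow> 'm set \<Rightarrow> ('o, 'm) cat" where
  "embedding_category A M = A\<lparr>Arr := M\<rparr>"


section \<open>Polyadic sets\<close>

text \<open>
  A functor from the opposite of a category to sets. The map \<open>FArr F f\<close> matters only on
  \<open>FObj F (Cod f)\<close>, whose elements it sends to \<open>FObj F (Dom f)\<close>.
\<close>

record ('o, 'm, 'x) set_functor =
  FObj :: "'o \<Rightarrow> 'x set"
  FArr :: "'m \<Rightarrow> 'x \<Rightarrow> 'x"

locale presheaf = category A
  for A :: "('o, 'm) cat" (structure) +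
  fixes F :: "('o, 'm, 'x) set_functor"
  assumes FArr_funcset: "f \<in> hom A a b \<Longrightarrow> FArr F f \<in> FObj F b \<rightarrow> FObj F a"
    and FArr_Ide: "a \<in> Obj A \<Longrightarrow> x \<in> FObj F a \<Longrightarrow> FArr F (Ide A a) x = x"
    and FArr_Comp: "f \<in> hom A a b \<Longrightarrow> g \<in> hom A b c \<Longrightarrow> x \<in> FObj F c \<Longrightarrow>
      FArr F (g \<cdot> f) x = FArr F f (FArr F g x)"

locale polyadic_set = presheaf A F
  for A :: "('o, 'm) cat" (structure) and F :: "('o, 'm, 'x) set_functor" +
  assumes amalgamation: "f \<in> hom A d a \<Longrightarrow> g \<in> hom A d b \<Longrightarrow>
      x \<in> FObj F a \<Longrightarrow> y \<in> FObj F b \<Longrightarrow> FArr F f x = FArr F g y \<Longrightarrow>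
      \<exists>c. \<exists>g' \<in> hom A a c. \<exists>f' \<in> hom A b c. g' \<cdot> f = f' \<cdot> g \<and>
        (\<exists>z \<in> FObj F c. FArr F g' z = x \<and> FArr F f' z = y)"

locale polyadic_finite_set = polyadic_set A F
  for A :: "('o, 'm) cat" (structure) and F :: "('o, 'm, 'x) set_functor" +
  assumes finite_FObj: "n \<in> Obj A \<Longrightarrow> finite (FObj F n)"

definition degenerate ::
  "('o, 'm) cat \<Rightarrow> 'm set \<Rightarrow> ('o, 'm, 'x) set_functor \<Rightarrow> 'o \<Rightarrow> 'x \<Rightarrow> bool" where
  "degenerate A Q F n x \<longleftrightarrow>
     (\<exists>m. \<exists>f \<in> hom A n m. proper_quotient A Q f \<and> (\<exists>y \<in> FObj F m. FArr F f y = x))"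

definition stirling_kernel ::
  "('o, 'm) cat \<Rightarrow> 'm set \<Rightarrow> ('o, 'm, 'x) set_functor \<Rightarrow> ('o, 'm, 'x) set_functor" where
  "stirling_kernel A Q F =
     \<lparr>FObj = (\<lambda>n. {x \<in> FObj F n. \<not> degenerate A Q F n x}), FArr = FArr F\<rparr>"

definition pointwise_isomorphic ::
  "('o, 'm) cat \<Rightarrow> ('o, 'm, 'x) set_functor \<Rightarrow> ('o, 'm, 'y) set_functor \<Rightarrow> bool" where
  "pointwise_isomorphic A F G \<longleftrightarrow> (\<forall>n \<in> Obj A. FObj F n \<approx> FObj G n)"


section \<open>The Stirling kernel is a functor on the category of embeddings\<close>

context proper_factorisation_system
begin

lemma Q_arr: "e \<in> Q \<Longrightarrow> e \<in> Arr A" and M_arr: "m \<in> M \<Longrightarrow> m \<in> Arr A"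
  by (simp add: Q_eq) (use M_eq in blast)

lemma lift:
  assumes "e \<in> Q" "m \<in> M" "e \<in> hom A a b" "m \<in> hom A c d" "u \<in> hom A a c" "v \<in> hom A b d"
    and "m \<cdot> u = v \<cdot> e"
  obtains k where "k \<in> hom A b c" "k \<cdot> e = u" "m \<cdot> k = v"
proof -
  have "lifts_against A e m"
    using assms(1,2) M_eq by blast
  then show thesis
    using assms that unfolding lifts_against_def hom_def by auto
qed

lemma Comp_in_M:
  assumes "m \<in> M" "n \<in> M" "m \<in> hom A a b" "n \<in> hom A b c"
  shows "n \<cdot> m \<in> M"
proof -
  have nm: "n \<cdot> m \<in> hom A a c"
    using assms Comp_in_hom by blast
  have "lifts_against A e (n \<cdot> m)" if e: "e \<in> Q" for e
    unfolding lifts_against_def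
  proof (intro ballI impI)
    fix u v
    assume u: "u \<in> hom A (Dom A e) (Dom A (n \<cdot> m))"
      and v: "v \<in> hom A (Cod A e) (Cod A (n \<cdot> m))"
      and sq: "(n \<cdot> m) \<cdot> u = v \<cdot> e"
    have u': "u \<in> hom A (Dom A e) a" and v': "v \<in> hom A (Cod A e) c"
      using u v nm by (auto simp: hom_def)
    have e': "e \<in> hom A (Dom A e) (Cod A e)"
      using Q_arr[OF e] by (simp add: hom_def)
    have "n \<cdot> (m \<cdot> u) = v \<cdot> e"
      using sq Comp_assoc[OF u' assms(3,4)] by simp
    then obtain k where k: "k \<in> hom A (Cod A e) b" "k \<cdot> e = m \<cdot> u" "n \<cdot> k = v"
      using lift[OF e assms(2) e' assms(4) Comp_in_hom[OF u' assms(3)] v'] by blast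
    obtain l where l: "l \<in> hom A (Cod A e) a" "l \<cdot> e = u" "m \<cdot> l = k"
      using lift[OF e assms(1) e' assms(3) u' k(1)] k(2) by metis
    have "(n \<cdot> m) \<cdot> l = v"
      using Comp_assoc[OF l(1) assms(3,4)] l k by simp
    then show "\<exists>d\<in>hom A (Cod A e) (Dom A (n \<cdot> m)). d \<cdot> e = u \<and> (n \<cdot> m) \<cdot> d = v"
      using l nm by (auto simp: hom_def)
  qed
  then show ?thesis
    using nm M_eq by (auto simp: hom_def)
qed

lemma iso_in_M:
  assumes "is_iso A f"
  shows "f \<in> M"
proof -
  have fA: "f \<in> Arr A"
    using assms by (simp add: is_iso_def)
  obtain g where g: "g \<in> hom A (Cod A f) (Dom A f)" "g \<cdot> f = Ide A (Dom A f)"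
      "f \<cdot> g = Ide A (Cod A f)"
    using assms unfolding is_iso_def by blast
  have f: "f \<in> hom A (Dom A f) (Cod A f)"
    using fA by (simp add: hom_def)
  have "lifts_against A e f" if e: "e \<in> Q" for e
    unfolding lifts_against_def
  proof (intro ballI impI)
    fix u v
    assume u: "u \<in> hom A (Dom A e) (Dom A f)" and v: "v \<in> hom A (Cod A e) (Cod A f)"
      and sq: "f \<cdot> u = v \<cdot> e"
    have e': "e \<in> hom A (Dom A e) (Cod A e)"
      using Q_arr[OF e] by (simp add: hom_def)
    have "(g \<cdot> v) \<cdot> e = u"
      using Comp_assoc[OF e' v g(1)] Comp_assoc[OF u f g(1)] sq g(2) Ide_Comp[OF u] by simp
    moreover have "f \<cdot> (g \<cdot> v) = v"
      using Comp_assoc[OF v g(1) f] g(3) Ide_Comp[OF v] by simp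
    ultimately show "\<exists>d\<in>hom A (Cod A e) (Dom A f). d \<cdot> e = u \<and> f \<cdot> d = v"
      using Comp_in_hom[OF v g(1)] by blast
  qed
  then show ?thesis
    using fA M_eq by blast
qed

lemma Ide_in_M:
  assumes "a \<in> Obj A"
  shows "Ide A a \<in> M"
proof -
  have i: "Ide A a \<in> hom A a a"
    using assms by (rule Ide_in_hom)
  then have "is_iso A (Ide A a)"
    using Comp_Ide[OF i] unfolding is_iso_def by (auto simp: hom_def)
  then show ?thesis
    by (rule iso_in_M)
qed

lemma category_embedding_category: "category (embedding_category A M)"
proof
  fix f a b g c
  assume "f \<in> hom (embedding_category A M) a b" "g \<in> hom (embedding_category A M) b c"
  then have fg: "f \<in> M" "g \<in> M" "f \<in> hom A a b" "g \<in> hom A b c"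
    using M_arr by (auto simp: hom_def embedding_category_def)
  show "g \<cdot>\<^bsub>embedding_category A M\<^esub> f \<in> hom (embedding_category A M) a c"
    using Comp_in_M[OF fg] Comp_in_hom[OF fg(3,4)]
    by (simp add: hom_def embedding_category_def)
next
  fix f a b g c h d
  assume "f \<in> hom (embedding_category A M) a b" "g \<in> hom (embedding_category A M) b c"
    "h \<in> hom (embedding_category A M) c d"
  then have "f \<in> hom A a b" "g \<in> hom A b c" "h \<in> hom A c d"
    using M_arr by (auto simp: hom_def embedding_category_def)
  then show "(h \<cdot>\<^bsub>embedding_category A M\<^esub> g) \<cdot>\<^bsub>embedding_category A M\<^esub> f =
      h \<cdot>\<^bsub>embedding_category A M\<^esub> (g \<cdot>\<^bsub>embedding_category A M\<^esub> f)"
    using Comp_assoc by (simp add: embedding_category_def)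
qed (use M_arr Ide_in_M Ide_in_hom Dom_in_Obj Cod_in_Obj Comp_Ide Ide_Comp in
    \<open>auto simp: hom_def embedding_category_def\<close>)

text \<open>An arrow hitting a generic element is an embedding.\<close>

lemma generic_imp_in_M:
  assumes "presheaf A F" "f \<in> hom A n c" "z \<in> FObj F c" "\<not> degenerate A Q F n (FArr F f z)"
  shows "f \<in> M"
proof -
  interpret F: presheaf A F by fact
  have "f \<in> Arr A" "Dom A f = n" "Cod A f = c"
    using assms(2) by (auto simp: hom_def)
  then obtain e m where em: "e \<in> Q" "m \<in> M" "Dom A e = n" "Cod A e = Dom A m"
      "Cod A m = c" "f = m \<cdot> e"
    using factorisation by metis
  have e: "e \<in> hom A n (Dom A m)" and m: "m \<in> hom A (Dom A m) c"
    using em Q_arr M_arr by (auto simp: hom_def)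
  have "FArr F f z = FArr F e (FArr F m z)"
    using F.FArr_Comp[OF e m assms(3)] em(6) by simp
  moreover have "FArr F m z \<in> FObj F (Dom A m)"
    using F.FArr_funcset[OF m] assms(3) by blast
  ultimately have "is_iso A e"
    using assms(4) e em(1) unfolding degenerate_def proper_quotient_def by metis
  then show ?thesis
    using Comp_in_M[OF iso_in_M em(2) e m] em(6) by simp
qed

lemma presheaf_stirling_kernel:
  assumes "polyadic_set A F"
  shows "presheaf (embedding_category A M) (stirling_kernel A Q F)"
proof -
  interpret F: polyadic_set A F by fact
  interpret E: category "embedding_category A M"
    by (rule category_embedding_category)
  have generic: "\<not> degenerate A Q F a (FArr F i x)"
    if i: "i \<in> M" "i \<in> hom A a b" and x: "x \<in> FObj F b" "\<not> degenerate A Q F b x" for i a b x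
  proof
    assume "degenerate A Q F a (FArr F i x)"
    then obtain k f y where f: "f \<in> hom A a k" "proper_quotient A Q f" and y: "y \<in> FObj F k"
        "FArr F f y = FArr F i x"
      unfolding degenerate_def by blast
    obtain c g' f' z where c: "g' \<in> hom A k c" "f' \<in> hom A b c" "g' \<cdot> f = f' \<cdot> i"
        "z \<in> FObj F c" "FArr F f' z = x"
      using F.amalgamation[OF f(1) i(2) y(1) x(1) y(2)] by blast
    have "f' \<in> M"
      using generic_imp_in_M[OF F.presheaf_axioms c(2,4)] c(5) x(2) by simp
    then have fi: "f' \<cdot> i \<in> M"
      using Comp_in_M i c(2) by blast
    have fQ: "f \<in> Q"
      using f(2) by (simp add: proper_quotient_def)
    have a: "Ide A a \<in> hom A a a" and k: "Ide A k \<in> hom A k k"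
      using f(1) Dom_in_Obj Cod_in_Obj Ide_in_hom by (auto simp: hom_def)
    have fi': "f' \<cdot> i \<in> hom A a c"
      using Comp_in_hom[OF i(2) c(2)] .
    obtain d where d: "d \<in> hom A k a" "d \<cdot> f = Ide A a"
      using lift[OF fQ fi f(1) fi' a c(1)] Comp_Ide[OF fi'] c(3) by metis
    have "(f \<cdot> d) \<cdot> f = Ide A k \<cdot> f"
      using Comp_assoc[OF f(1) d(1) f(1)] d(2) Comp_Ide[OF f(1)] Ide_Comp[OF f(1)] by simp
    moreover have "Cod A f = k" "Dom A f = a" "f \<in> Arr A"
      using f(1) by (auto simp: hom_def)
    ultimately have "f \<cdot> d = Ide A k"
      using Q_epi[OF fQ] Comp_in_hom[OF d(1) f(1)] k unfolding is_epi_def by blast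
    then have "is_iso A f"
      using d \<open>Cod A f = k\<close> \<open>Dom A f = a\<close> \<open>f \<in> Arr A\<close> unfolding is_iso_def by blast
    then show False
      using f(2) by (simp add: proper_quotient_def)
  qed
  have hom: "f \<in> M \<and> f \<in> hom A a b" if "f \<in> hom (embedding_category A M) a b" for f a b
    using that M_arr by (auto simp: hom_def embedding_category_def)
  show ?thesis
  proof
    fix f a b
    assume "f \<in> hom (embedding_category A M) a b"
    then have f: "f \<in> M" "f \<in> hom A a b"
      using hom by blast+
    then show "FArr (stirling_kernel A Q F) f \<in>
        FObj (stirling_kernel A Q F) b \<rightarrow> FObj (stirling_kernel A Q F) a"
      using generic[OF f] F.FArr_funcset[OF f(2)] by (auto simp: stirling_kernel_def)
  next
    fix f a b g c x
    assume "f \<in> hom (embedding_category A M) a b" "g \<in> hom (embedding_category A M) b c"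
      and "x \<in> FObj (stirling_kernel A Q F) c"
    then show "FArr (stirling_kernel A Q F) (g \<cdot>\<^bsub>embedding_category A M\<^esub> f) x =
        FArr (stirling_kernel A Q F) f (FArr (stirling_kernel A Q F) g x)"
      using hom F.FArr_Comp by (fastforce simp: stirling_kernel_def embedding_category_def)
  qed (use F.FArr_Ide in \<open>auto simp: stirling_kernel_def embedding_category_def\<close>)
qed

end

end

theory Submission
  imports Defs
begin

text \<open>
  Every element \<open>x\<close> of \<open>F n\<close> is \<open>F q y\<close> for a quotient \<open>q\<close> and a generic \<open>y\<close>: by
  well-foundedness take \<open>q\<close> minimal with \<open>x\<close> in the image of \<open>F q\<close>. By amalgamation
  \<open>q\<close> is unique up to equivalence of quotients, and \<open>y\<close> is determined by \<open>q\<close>. So the degenerate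
  elements of \<open>F n\<close> form the disjoint union of the sets of generic elements of \<open>F m\<close>, over the
  equivalence classes of proper quotients from \<open>n\<close> to \<open>m\<close>. If the kernels of \<open>F\<close> and \<open>G\<close> agree
  at the codomains of all proper quotients of \<open>n\<close>, then \<open>F n\<close> and \<open>G n\<close> have equally many
  degenerate elements, and hence, being finite of the same size, equally many generic ones; the
  theorem follows by well-founded induction on quotients.
\<close>

section \<open>Arrows and finite cardinalities\<close>

lemma homI: "f \<in> Arr A \<Longrightarrow> f \<in> hom A (Dom A f) (Cod A f)"
  by (simp add: hom_def)

lemma homD:
  assumes "f \<in> hom A a b"
  shows "f \<in> Arr A" "Dom A f = a" "Cod A f = b"
  using assms by (simp_all add: hom_def)

text \<open>Finiteness makes cardinals cancellable; for infinite sets, removing equipotent subsets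
  can leave remainders of different sizes.\<close>

lemma eqpoll_Diff_finite:
  assumes "S \<approx> T" "finite S" "S' \<subseteq> S" "T' \<subseteq> T" "S' \<approx> T'"
  shows "S - S' \<approx> T - T'"
proof -
  have fin: "finite T" "finite S'" "finite T'"
    using assms eqpoll_finite_iff finite_subset by metis+
  then have "card (S - S') = card (T - T')"
    using assms by (simp add: card_Diff_subset eqpoll_iff_card)
  then show ?thesis
    using assms(2) fin by (simp add: eqpoll_iff_card)
qed

context proper_factorisation_system
begin

section \<open>Quotients up to equivalence\<close>

definition quot_equiv :: "'m \<Rightarrow> 'm \<Rightarrow> bool" where
  "quot_equiv p q \<longleftrightarrow> p \<in> Q \<and> q \<in> Q \<and> Dom A p = Dom A q \<and> quot_le A p q \<and> quot_le A q p"

text \<open>A transversal: equivalent \<open>q\<close> give \<open>SOME\<close> the same predicate,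
  hence the same choice. Arrows rather than classes serve as indices because a class fixes its
  codomain only up to isomorphism.\<close>

definition proper_quot_reps :: "'o \<Rightarrow> 'm set" where
  "proper_quot_reps n = (\<lambda>q. SOME p. quot_equiv p q) ` {q. proper_quotient A Q q \<and> Dom A q = n}"

section \<open>Composition and cancellation of quotients\<close>

lemma Q_cancel:
  assumes "e \<in> Q" "e \<in> hom A a b" "g \<in> hom A b c" "h \<in> hom A b c" "g \<cdot> e = h \<cdot> e"
  shows "g = h"
  using Q_epi[OF assms(1)] homD[OF assms(2)] assms(3-) unfolding is_epi_def by blast

text \<open>Fill the square across \<open>e\<close> first; the filler is the top edge of a square
  across \<open>f\<close>, whose filler solves the original problem.\<close>

lemma Comp_in_Q:
  assumes "e \<in> Q" "f \<in> Q" "e \<in> hom A a b" "f \<in> hom A b c"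
  shows "f \<cdot> e \<in> Q"
proof -
  have fe: "f \<cdot> e \<in> hom A a c"
    using assms Comp_in_hom by blast
  have "lifts_against A (f \<cdot> e) m" if m: "m \<in> M" for m
    unfolding lifts_against_def
  proof (intro ballI impI)
    fix u v
    assume u: "u \<in> hom A (Dom A (f \<cdot> e)) (Dom A m)"
      and v: "v \<in> hom A (Cod A (f \<cdot> e)) (Cod A m)"
      and sq: "m \<cdot> u = v \<cdot> (f \<cdot> e)"
    have u': "u \<in> hom A a (Dom A m)" and v': "v \<in> hom A c (Cod A m)"
      using u v homD[OF fe] by simp_all
    have m': "m \<in> hom A (Dom A m) (Cod A m)"
      using M_arr[OF m] by (rule homI)
    have "m \<cdot> u = (v \<cdot> f) \<cdot> e"
      using sq Comp_assoc[OF assms(3,4) v'] by simp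
    then obtain k where k: "k \<in> hom A b (Dom A m)" "k \<cdot> e = u" "m \<cdot> k = v \<cdot> f"
      using lift[OF assms(1) m assms(3) m' u' Comp_in_hom[OF assms(4) v']] by blast
    obtain l where l: "l \<in> hom A c (Dom A m)" "l \<cdot> f = k" "m \<cdot> l = v"
      using lift[OF assms(2) m assms(4) m' k(1) v' k(3)] by blast
    have "l \<cdot> (f \<cdot> e) = u"
      using Comp_assoc[OF assms(3,4) l(1)] l k by simp
    then show "\<exists>d\<in>hom A (Cod A (f \<cdot> e)) (Dom A m). d \<cdot> (f \<cdot> e) = u \<and> m \<cdot> d = v"
      using l homD[OF fe] by auto
  qed
  then show ?thesis
    using homD[OF fe] Q_eq by blast
qed

lemma Ide_in_Q:
  assumes "a \<in> Obj A"
  shows "Ide A a \<in> Q"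
proof -
  have i: "Ide A a \<in> hom A a a"
    using assms by (rule Ide_in_hom)
  have "lifts_against A (Ide A a) m" for m
    unfolding lifts_against_def
    using homD[OF i] Comp_Ide by metis
  then show ?thesis
    using homD[OF i] Q_eq by blast
qed

text \<open>\<open>e\<close> after \<open>h\<close> agrees with the identity once precomposed with
  \<open>e\<close>. As \<open>e\<close> is an epimorphism, the left inverse \<open>h\<close> is
  two-sided.\<close>

lemma split_mono_in_Q_iso:
  assumes "e \<in> Q" "e \<in> hom A a b" "h \<in> hom A b a" "h \<cdot> e = Ide A a"
  shows "is_iso A e"
proof -
  have "b \<in> Obj A"
    using Cod_in_Obj homD[OF assms(2)] by metis
  then have b: "Ide A b \<in> hom A b b"
    by (rule Ide_in_hom)
  have "(e \<cdot> h) \<cdot> e = Ide A b \<cdot> e"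
    using Comp_assoc[OF assms(2,3,2)] assms(4) Comp_Ide[OF assms(2)] Ide_Comp[OF assms(2)] by simp
  then have "e \<cdot> h = Ide A b"
    using Q_cancel[OF assms(1,2) Comp_in_hom[OF assms(3,2)] b] by blast
  then show ?thesis
    using assms homD[OF assms(2)] unfolding is_iso_def by auto
qed

text \<open>Following \<open>f\<close> by an inverse of the composite gives a left inverse of
  \<open>e\<close>. Contrapositively, a proper quotient followed by any arrow is not an
  isomorphism.\<close>

lemma iso_Comp_imp_iso:
  assumes "e \<in> Q" "e \<in> hom A a b" "f \<in> hom A b c" "is_iso A (f \<cdot> e)"
  shows "is_iso A e"
proof -
  have fe: "f \<cdot> e \<in> hom A a c"
    using assms Comp_in_hom by blast
  obtain g where g: "g \<in> hom A c a" "g \<cdot> (f \<cdot> e) = Ide A a"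
    using assms(4) homD[OF fe] unfolding is_iso_def by auto
  then have "(g \<cdot> f) \<cdot> e = Ide A a"
    using Comp_assoc[OF assms(2,3) g(1)] by simp
  then show ?thesis
    using split_mono_in_Q_iso[OF assms(1,2) Comp_in_hom[OF assms(3) g(1)]] by blast
qed

text \<open>Cancel \<open>q\<close> on the right. Applied in both directions, this shows that
  comparison arrows between equivalent quotients are mutually inverse.\<close>

lemma Q_Comp_Comp_eq_self:
  assumes "q \<in> Q" "q \<in> hom A a b" "p \<in> hom A b c" "h \<in> hom A c b" "h \<cdot> (p \<cdot> q) = q"
  shows "h \<cdot> p = Ide A b"
proof -
  have b: "Ide A b \<in> hom A b b"
    using Cod_in_Obj[of q] homD[OF assms(2)] Ide_in_hom by simp
  have "(h \<cdot> p) \<cdot> q = Ide A b \<cdot> q"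
    using Comp_assoc[OF assms(2-4)] assms(5) Ide_Comp[OF assms(2)] by simp
  then show ?thesis
    using Q_cancel[OF assms(1,2) Comp_in_hom[OF assms(3,4)] b] by blast
qed

text \<open>Strict descent: a proper quotient \<open>p\<close> after \<open>q\<close> lies below
  \<open>q\<close> but not above it.\<close>

lemma quot_le_Comp_imp_iso:
  assumes "q \<in> Q" "q \<in> hom A a b" "p \<in> Q" "p \<in> hom A b c" "quot_le A q (p \<cdot> q)"
  shows "is_iso A p"
proof -
  obtain h where h: "h \<in> hom A c b" "q = h \<cdot> (p \<cdot> q)"
    using assms(5) homD[OF assms(2)] homD[OF Comp_in_hom[OF assms(2,4)]]
    unfolding quot_le_def by auto
  have "h \<cdot> p = Ide A b"
    using Q_Comp_Comp_eq_self[OF assms(1,2,4) h(1)] h(2) by argo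
  then show ?thesis
    using split_mono_in_Q_iso[OF assms(3,4) h(1)] by blast
qed

section \<open>The preorder of quotients and its minimal elements\<close>

lemma quot_le_refl:
  assumes "f \<in> Arr A"
  shows "quot_le A f f"
  unfolding quot_le_def using Ide_in_hom Cod_in_Obj Ide_Comp[OF homI] assms by metis

lemma quot_le_trans:
  assumes "quot_le A f g" "quot_le A g h" "h \<in> Arr A"
  shows "quot_le A f h"
proof -
  obtain u v where "u \<in> hom A (Cod A g) (Cod A f)" "f = u \<cdot> g"
      "v \<in> hom A (Cod A h) (Cod A g)" "g = v \<cdot> h"
    using assms unfolding quot_le_def by blast
  then show ?thesis
    unfolding quot_le_def using Comp_in_hom Comp_assoc[OF homI[OF assms(3)]] by metis
qed

lemma quot_equiv_refl: "q \<in> Q \<Longrightarrow> quot_equiv q q"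
  by (simp add: quot_equiv_def quot_le_refl Q_arr)

lemma quot_equiv_sym: "quot_equiv p q \<Longrightarrow> quot_equiv q p"
  by (simp add: quot_equiv_def)

lemma quot_equiv_trans: "quot_equiv p q \<Longrightarrow> quot_equiv q r \<Longrightarrow> quot_equiv p r"
  unfolding quot_equiv_def using quot_le_trans Q_arr by metis

text \<open>\<open>p\<close> is an arrow after \<open>q\<close>, so inverting \<open>p\<close> would
  invert \<open>q\<close>. Hence the representative of a proper quotient is proper.\<close>

lemma proper_quotient_quot_equiv:
  assumes "proper_quotient A Q q" "quot_equiv p q"
  shows "proper_quotient A Q p"
proof -
  have Q: "p \<in> Q" "q \<in> Q" "Dom A p = Dom A q"
    using assms(2) by (auto simp: quot_equiv_def)
  obtain h where h: "h \<in> hom A (Cod A q) (Cod A p)" "p = h \<cdot> q"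
    using assms(2) by (auto simp: quot_equiv_def quot_le_def)
  show ?thesis
    using iso_Comp_imp_iso[OF Q(2) homI[OF Q_arr[OF Q(2)]] h(1)] h(2) Q(1) assms(1)
    by (auto simp: proper_quotient_def)
qed

lemma ex_proper_quot_rep:
  assumes "proper_quotient A Q q" "Dom A q = n"
  obtains p where "p \<in> proper_quot_reps n" "quot_equiv p q"
proof -
  have "quot_equiv (SOME p. quot_equiv p q) q"
    using assms quot_equiv_refl by (metis someI proper_quotient_def)
  then show thesis
    using that assms unfolding proper_quot_reps_def by blast
qed

text \<open>The third fact, that a representative is the choice made for its own class, is what
  makes representatives unique.\<close>

lemma proper_quot_repsD:
  assumes "p \<in> proper_quot_reps n"
  shows "proper_quotient A Q p" "Dom A p = n" "p = (SOME r. quot_equiv r p)"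
proof -
  obtain q where q: "p = (SOME r. quot_equiv r q)" "proper_quotient A Q q" "Dom A q = n"
    using assms unfolding proper_quot_reps_def by blast
  then have pq: "quot_equiv p q"
    using quot_equiv_refl by (metis someI proper_quotient_def)
  then show "proper_quotient A Q p" "Dom A p = n"
    using q proper_quotient_quot_equiv by (auto simp: quot_equiv_def)
  have "quot_equiv r p \<longleftrightarrow> quot_equiv r q" for r
    using pq quot_equiv_sym quot_equiv_trans by blast
  then have "(SOME r. quot_equiv r q) = (SOME r. quot_equiv r p)"
    by simp
  with q(1) show "p = (SOME r. quot_equiv r p)"
    by (rule trans)
qed

lemma proper_quot_reps_unique:
  assumes "p \<in> proper_quot_reps n" "q \<in> proper_quot_reps n" "quot_equiv p q"
  shows "p = q"
proof -
  have "quot_equiv r p \<longleftrightarrow> quot_equiv r q" for r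
    using assms(3) quot_equiv_sym quot_equiv_trans by blast
  then show ?thesis
    using proper_quot_repsD(3)[OF assms(1)] proper_quot_repsD(3)[OF assms(2)] by presburger
qed

text \<open>Transfers well-foundedness from classes to arrows. \<open>P\<close> is arbitrary and may
  separate equivalent arrows, so \<open>T\<close> collects the classes with at least one member
  satisfying \<open>P\<close>.\<close>

lemma minimal_quotient:
  assumes wf: "quotient_well_founded A Q" and q0: "q0 \<in> Q" "P q0"
  obtains q where "q \<in> Q" "Dom A q = Dom A q0" "P q"
    "\<And>p m. proper_quotient A Q p \<Longrightarrow> p \<in> hom A (Cod A q) m \<Longrightarrow> \<not> P (p \<cdot> q)"
proof -
  define a where "a = Dom A q0"
  define S where "S = {f \<in> Q. Dom A f = a}"
  define R where "R = order_equiv (quot_le A) S"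
  define T where "T = {R `` {q} |q. q \<in> S \<and> P q}"
  have R: "(f, g) \<in> R \<longleftrightarrow> quot_equiv f g \<and> Dom A f = a" for f g
    by (auto simp: R_def S_def order_equiv_def quot_equiv_def)
  have "a \<in> Obj A"
    using q0 Q_arr Dom_in_Obj by (simp add: a_def)
  moreover have "T \<subseteq> quotients_by A Q a"
    by (auto simp: T_def quotients_by_def Let_def quotient_def R_def S_def)
  moreover have "T \<noteq> {}"
    using q0 by (auto simp: T_def S_def a_def)
  ultimately obtain X where X: "X \<in> T" "\<And>Y. Y \<in> T \<Longrightarrow> quot_class_le A Y X \<Longrightarrow> Y = X"
    using wf unfolding quotient_well_founded_def by meson
  then obtain q where q: "X = R `` {q}" "q \<in> Q" "Dom A q = a" "P q"
    by (auto simp: T_def S_def)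
  have qX: "q \<in> X"
    using q R quot_equiv_refl by simp
  have qh: "q \<in> hom A a (Cod A q)"
    using homI[OF Q_arr[OF q(2)]] q(3) by simp
  have "\<not> P (p \<cdot> q)" if p: "proper_quotient A Q p" "p \<in> hom A (Cod A q) m" for p m
  proof
    assume Ppq: "P (p \<cdot> q)"
    have pQ: "p \<in> Q"
      using p by (simp add: proper_quotient_def)
    have pq: "p \<cdot> q \<in> Q" "p \<cdot> q \<in> hom A a m"
      using Comp_in_Q[OF q(2) pQ qh p(2)] Comp_in_hom[OF qh p(2)] by auto
    have "R `` {p \<cdot> q} \<in> T"
      using pq Ppq homD[OF pq(2)] by (auto simp: T_def S_def)
    moreover have "p \<cdot> q \<in> R `` {p \<cdot> q}"
      using R quot_equiv_refl pq(1) homD[OF pq(2)] by simp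
    moreover have "quot_le A (p \<cdot> q) q"
      using p(2) homD[OF pq(2)] unfolding quot_le_def by auto
    \<comment> \<open>The class of \<open>p\<close> after \<open>q\<close> lies below the minimal
      class \<open>X\<close>, so the two coincide and \<open>q\<close> lies below the composite,
      against strict descent.\<close>
    ultimately have "R `` {p \<cdot> q} = X"
      using X(2) qX unfolding quot_class_le_def by blast
    then have "quot_le A q (p \<cdot> q)"
      using qX R by (auto simp: quot_equiv_def)
    then show False
      using quot_le_Comp_imp_iso[OF q(2) qh pQ p(2)] p(1) by (simp add: proper_quotient_def)
  qed
  then show thesis
    using that q a_def by blast
qed

section \<open>Generic elements and their quotients\<close>

lemma ex_generic:
  assumes "presheaf A F" and wf: "quotient_well_founded A Q" and n: "n \<in> Obj A"
    and x: "x \<in> FObj F n"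
  obtains q y where "q \<in> Q" "q \<in> hom A n (Cod A q)" "y \<in> FObj F (Cod A q)"
    "\<not> degenerate A Q F (Cod A q) y" "FArr F q y = x"
proof -
  interpret F: presheaf A F by fact
  define P where "P q \<longleftrightarrow> (\<exists>y \<in> FObj F (Cod A q). FArr F q y = x)" for q
  \<comment> \<open>\<open>x\<close> comes from itself along the identity, which starts the search
    for a minimal quotient.\<close>
  have "P (Ide A n)" "Dom A (Ide A n) = n"
    using F.FArr_Ide[OF n x] x homD[OF Ide_in_hom[OF n]] by (auto simp: P_def)
  then obtain q where q: "q \<in> Q" "Dom A q = n" "P q"
      "\<And>p m. proper_quotient A Q p \<Longrightarrow> p \<in> hom A (Cod A q) m \<Longrightarrow> \<not> P (p \<cdot> q)"
    using minimal_quotient[OF wf Ide_in_Q[OF n], of P] by metis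
  have qh: "q \<in> hom A n (Cod A q)"
    using homI[OF Q_arr[OF q(1)]] q(2) by simp
  obtain y where y: "y \<in> FObj F (Cod A q)" "FArr F q y = x"
    using q(3) P_def by blast
  \<comment> \<open>If \<open>y\<close> came from a proper quotient \<open>p\<close>, then
    \<open>x\<close> would come from \<open>p\<close> after \<open>q\<close>, against
    minimality.\<close>
  have "\<not> degenerate A Q F (Cod A q) y"
  proof
    assume "degenerate A Q F (Cod A q) y"
    then obtain m p w where p: "p \<in> hom A (Cod A q) m" "proper_quotient A Q p"
        "w \<in> FObj F m" "FArr F p w = y"
      unfolding degenerate_def by blast
    then have "P (p \<cdot> q)"
      using F.FArr_Comp[OF qh p(1,3)] y(2) homD[OF Comp_in_hom[OF qh p(1)]]
      by (auto simp: P_def)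
    then show False
      using q(4) p by blast
  qed
  then show thesis
    using that q(1) qh y by blast
qed

text \<open>Amalgamating \<open>y\<close> and \<open>z\<close> gives a square with \<open>q\<close>
  on the left and \<open>f\<close> on the right. Since \<open>f\<close> hits the generic
  \<open>z\<close>, it is an embedding, and the diagonal filler is the comparison arrow.\<close>

lemma generic_quot_le:
  assumes "polyadic_set A F"
    and q: "q \<in> Q" "q \<in> hom A n b" and r: "r \<in> hom A n c"
    and y: "y \<in> FObj F b" and z: "z \<in> FObj F c" "\<not> degenerate A Q F c z"
    and eq: "FArr F q y = FArr F r z"
  shows "quot_le A r q"
proof -
  interpret F: polyadic_set A F by fact
  obtain d g f w where d: "g \<in> hom A b d" "f \<in> hom A c d" "g \<cdot> q = f \<cdot> r"
      "w \<in> FObj F d" "FArr F f w = z"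
    using F.amalgamation[OF q(2) r y z(1) eq] by blast
  have "f \<in> M"
    using generic_imp_in_M[OF F.presheaf_axioms d(2,4)] d(5) z(2) by simp
  then obtain k where "k \<in> hom A b c" "k \<cdot> q = r"
    using lift[OF q(1) _ q(2) d(2) r d(1)] d(3) by metis
  then show ?thesis
    using homD[OF q(2)] homD[OF r] unfolding quot_le_def by auto
qed

text \<open>Amalgamate along two copies of \<open>q\<close>: the resulting arrows \<open>g\<close>
  and \<open>f\<close> agree after \<open>q\<close>, hence are equal, and they send the same
  \<open>w\<close> to \<open>y\<close> and \<open>z\<close>.\<close>

lemma FArr_Q_inj:
  assumes "polyadic_set A F" and q: "q \<in> Q" "q \<in> hom A n b"
    and y: "y \<in> FObj F b" "z \<in> FObj F b" "FArr F q y = FArr F q z"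
  shows "y = z"
proof -
  interpret F: polyadic_set A F by fact
  obtain d g f w where d: "g \<in> hom A b d" "f \<in> hom A b d" "g \<cdot> q = f \<cdot> q"
      "FArr F g w = y" "FArr F f w = z"
    using F.amalgamation[OF q(2) q(2) y] by blast
  then show ?thesis
    using Q_cancel[OF q d(1,2,3)] by simp
qed

lemma iso_in_Q:
  assumes k: "k \<in> hom A a b" and l: "l \<in> hom A b a"
    and lk: "l \<cdot> k = Ide A a" and kl: "k \<cdot> l = Ide A b"
  shows "k \<in> Q"
proof -
  have "lifts_against A k m" if m: "m \<in> M" for m
    unfolding lifts_against_def
  proof (intro ballI impI)
    fix u v
    assume "u \<in> hom A (Dom A k) (Dom A m)" "v \<in> hom A (Cod A k) (Cod A m)"
      and sq: "m \<cdot> u = v \<cdot> k"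
    then have u: "u \<in> hom A a (Dom A m)" and v: "v \<in> hom A b (Cod A m)"
      using homD[OF k] by simp_all
    have m': "m \<in> hom A (Dom A m) (Cod A m)"
      using M_arr[OF m] by (rule homI)
    have "(u \<cdot> l) \<cdot> k = u"
      using Comp_assoc[OF k l u] lk Comp_Ide[OF u] by simp
    moreover have "m \<cdot> (u \<cdot> l) = v"
      using Comp_assoc[OF l u m'] Comp_assoc[OF l k v] sq kl Comp_Ide[OF v] by simp
    ultimately show "\<exists>d\<in>hom A (Cod A k) (Dom A m). d \<cdot> k = u \<and> m \<cdot> d = v"
      using Comp_in_hom[OF l u] homD[OF k] by auto
  qed
  then show ?thesis
    using homD[OF k] Q_eq by blast
qed

text \<open>Genericity must be carried along an isomorphism because equivalent quotients can have
  different codomains. If \<open>F k y\<close> comes from \<open>p\<close>, then \<open>y\<close>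
  comes from \<open>p\<close> after \<open>l\<close>.\<close>

lemma degenerate_iso:
  assumes "presheaf A F" and k: "k \<in> hom A a b" and l: "l \<in> hom A b a"
    and lk: "l \<cdot> k = Ide A a" and kl: "k \<cdot> l = Ide A b"
    and y: "y \<in> FObj F b" and deg: "degenerate A Q F a (FArr F k y)"
  shows "degenerate A Q F b y"
proof -
  interpret F: presheaf A F by fact
  obtain m p w where p: "p \<in> hom A a m" "proper_quotient A Q p" and w: "w \<in> FObj F m"
      "FArr F p w = FArr F k y"
    using deg unfolding degenerate_def by blast
  have pQ: "p \<in> Q" and lQ: "l \<in> Q"
    using p(2) iso_in_Q[OF l k kl lk] by (auto simp: proper_quotient_def)
  have pl: "p \<cdot> l \<in> hom A b m"
    using Comp_in_hom[OF l p(1)] .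
  \<comment> \<open>An inverse of the composite would place \<open>l\<close> below it, forcing
    \<open>p\<close> to be invertible.\<close>
  have "\<not> is_iso A (p \<cdot> l)"
  proof
    assume "is_iso A (p \<cdot> l)"
    then obtain g where g: "g \<in> hom A m b" "g \<cdot> (p \<cdot> l) = Ide A b"
      using homD[OF pl] unfolding is_iso_def by auto
    then have "l = (l \<cdot> g) \<cdot> (p \<cdot> l)"
      using Comp_assoc[OF pl g(1) l] Comp_Ide[OF l] by simp
    then have "quot_le A l (p \<cdot> l)"
      using Comp_in_hom[OF g(1) l] homD[OF pl] homD[OF l] unfolding quot_le_def by auto
    then show False
      using quot_le_Comp_imp_iso[OF lQ l pQ p(1)] p(2) by (simp add: proper_quotient_def)
  qed
  moreover have "FArr F (p \<cdot> l) w = y"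
  proof -
    have "b \<in> Obj A"
      using Cod_in_Obj homD[OF k] by metis
    then show ?thesis
      using F.FArr_Comp[OF l p(1) w(1)] F.FArr_Comp[OF l k y] F.FArr_Ide[OF _ y] w(2) kl by simp
  qed
  ultimately show ?thesis
    using pl w(1) Comp_in_Q[OF lQ pQ l p(1)] unfolding degenerate_def proper_quotient_def by blast
qed

section \<open>Counting degenerate and generic elements\<close>

lemma degenerate_eqpoll:
  assumes "polyadic_set A F" and wf: "quotient_well_founded A Q" and n: "n \<in> Obj A"
  shows "(SIGMA q:proper_quot_reps n. FObj (stirling_kernel A Q F) (Cod A q))
    \<approx> {x \<in> FObj F n. degenerate A Q F n x}" (is "?S \<approx> ?D")
proof -
  interpret F: polyadic_set A F by fact
  define h where "h = (\<lambda>(q, y). FArr F q y)"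
  have rep: "proper_quotient A Q q" "q \<in> Q" "q \<in> hom A n (Cod A q)"
    if "q \<in> proper_quot_reps n" for q
    using proper_quot_repsD(1,2)[OF that] Q_arr by (auto simp: proper_quotient_def hom_def)
  have "inj_on h ?S"
  proof (intro inj_onI, clarify)
    fix q y r z
    assume q: "q \<in> proper_quot_reps n" and r: "r \<in> proper_quot_reps n"
      and "y \<in> FObj (stirling_kernel A Q F) (Cod A q)"
        "z \<in> FObj (stirling_kernel A Q F) (Cod A r)" "h (q, y) = h (r, z)"
    then have y: "y \<in> FObj F (Cod A q)" "\<not> degenerate A Q F (Cod A q) y"
      and z: "z \<in> FObj F (Cod A r)" "\<not> degenerate A Q F (Cod A r) z"
      and eq: "FArr F q y = FArr F r z"
      by (auto simp: stirling_kernel_def h_def)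
    \<comment> \<open>Both \<open>y\<close> and \<open>z\<close> are generic, so the comparison
      holds in each direction.\<close>
    have "quot_le A r q" "quot_le A q r"
      using generic_quot_le[OF F.polyadic_set_axioms rep(2,3)[OF q] rep(3)[OF r] y(1) z eq]
        generic_quot_le[OF F.polyadic_set_axioms rep(2,3)[OF r] rep(3)[OF q] z(1) y eq[symmetric]]
      by auto
    then have qr: "q = r"
      using proper_quot_reps_unique[OF q r] rep(2) q r proper_quot_repsD(2)
      by (auto simp: quot_equiv_def)
    then show "q = r \<and> y = z"
      using FArr_Q_inj[OF F.polyadic_set_axioms rep(2,3)[OF q]] y(1) z(1) eq by simp
  qed
  moreover have "h ` ?S = ?D"
  proof (intro equalityI subsetI)
    fix x
    assume "x \<in> h ` ?S"
    then obtain q y where q: "q \<in> proper_quot_reps n" and y: "y \<in> FObj F (Cod A q)"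
        "x = FArr F q y"
      by (auto simp: stirling_kernel_def h_def)
    then show "x \<in> ?D"
      using rep[OF q] F.FArr_funcset[OF rep(3)[OF q]] unfolding degenerate_def by blast
  next
    fix x
    assume x: "x \<in> ?D"
    then obtain m f w where f: "f \<in> hom A n m" "proper_quotient A Q f" and w: "w \<in> FObj F m"
        "FArr F f w = x"
      unfolding degenerate_def by blast
    have fQ: "f \<in> Q"
      using f(2) by (simp add: proper_quotient_def)
    have "m \<in> Obj A"
      using Cod_in_Obj homD[OF f(1)] by metis
    then obtain e y where e: "e \<in> Q" "e \<in> hom A m (Cod A e)" and y: "y \<in> FObj F (Cod A e)"
        "\<not> degenerate A Q F (Cod A e) y" "FArr F e y = w"
      using ex_generic[OF F.presheaf_axioms wf _ w(1)] by metis
    \<comment> \<open>\<open>x\<close> comes from the generic \<open>y\<close> along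
      \<open>e\<close> after \<open>f\<close>, which need not be a chosen representative. So it is
      replaced by the equivalent \<open>q\<close>, and \<open>y\<close> by its image under
      \<open>F k\<close>.\<close>
    have ef: "e \<cdot> f \<in> hom A n (Cod A e)" "e \<cdot> f \<in> Q"
      using Comp_in_hom[OF f(1) e(2)] Comp_in_Q[OF fQ e(1) f(1) e(2)] by auto
    then have "proper_quotient A Q (e \<cdot> f)"
      using iso_Comp_imp_iso[OF fQ f(1) e(2)] f(2) by (auto simp: proper_quotient_def)
    then obtain q where q: "q \<in> proper_quot_reps n" "quot_equiv q (e \<cdot> f)"
      using ex_proper_quot_rep homD[OF ef(1)] by metis
    obtain k where k: "k \<in> hom A (Cod A q) (Cod A e)" "e \<cdot> f = k \<cdot> q"
      using q(2) homD[OF ef(1)] by (auto simp: quot_equiv_def quot_le_def)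
    obtain l where l: "l \<in> hom A (Cod A e) (Cod A q)" "q = l \<cdot> (e \<cdot> f)"
      using q(2) homD[OF ef(1)] by (auto simp: quot_equiv_def quot_le_def)
    have ky: "FArr F k y \<in> FObj F (Cod A q)"
      using F.FArr_funcset[OF k(1)] y(1) by blast
    have xq: "x = FArr F q (FArr F k y)"
      using F.FArr_Comp[OF f(1) e(2) y(1)] F.FArr_Comp[OF rep(3)[OF q(1)] k(1) y(1)] k(2) w(2) y(3)
      by simp
    \<comment> \<open>Each factorisation is substituted into the other; cancelling the quotients
      makes \<open>k\<close> and \<open>l\<close> mutually inverse.\<close>
    have "l \<cdot> (k \<cdot> q) = q" "k \<cdot> (l \<cdot> (e \<cdot> f)) = e \<cdot> f"
      unfolding k(2)[symmetric] l(2)[symmetric] by (rule refl)+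
    then have lk: "l \<cdot> k = Ide A (Cod A q)" and kl: "k \<cdot> l = Ide A (Cod A e)"
      using Q_Comp_Comp_eq_self[OF rep(2,3)[OF q(1)] k(1) l(1)] Q_Comp_Comp_eq_self[OF ef(2,1) l(1) k(1)]
      by blast+
    have "\<not> degenerate A Q F (Cod A q) (FArr F k y)"
      using degenerate_iso[OF F.presheaf_axioms k(1) l(1) _ _ y(1)] y(2) lk kl by blast
    then have "(q, FArr F k y) \<in> ?S"
      using q(1) ky by (simp add: stirling_kernel_def)
    then show "x \<in> h ` ?S"
      using imageI[of "(q, FArr F k y)" ?S h] xq by (simp add: h_def)
  qed
  ultimately show ?thesis
    unfolding eqpoll_def bij_betw_def by blast
qed

lemma generic_eqpoll_step:
  assumes F: "polyadic_finite_set A F" and G: "polyadic_finite_set A G"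
    and wf: "quotient_well_founded A Q" and n: "n \<in> Obj A" and FG: "FObj F n \<approx> FObj G n"
    and IH: "\<And>q. proper_quotient A Q q \<Longrightarrow> Dom A q = n \<Longrightarrow>
      FObj (stirling_kernel A Q F) (Cod A q) \<approx> FObj (stirling_kernel A Q G) (Cod A q)"
  shows "FObj (stirling_kernel A Q F) n \<approx> FObj (stirling_kernel A Q G) n"
proof -
  interpret F: polyadic_finite_set A F by fact
  interpret G: polyadic_finite_set A G by fact
  have "{x \<in> FObj F n. degenerate A Q F n x}
      \<approx> (SIGMA q:proper_quot_reps n. FObj (stirling_kernel A Q F) (Cod A q))"
    using degenerate_eqpoll[OF F.polyadic_set_axioms wf n] by (rule eqpoll_sym)
  \<comment> \<open>The representatives depend only on \<open>A\<close> and \<open>Q\<close>, so the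
    identity matches the index sets of \<open>F\<close> and \<open>G\<close>.\<close>
  also have "\<dots> \<approx> (SIGMA q:proper_quot_reps n. FObj (stirling_kernel A Q G) (Cod A q))"
    by (rule Sigma_eqpoll_cong[OF bij_betw_id]) (use IH proper_quot_repsD(1,2) in simp)
  also have "\<dots> \<approx> {x \<in> FObj G n. degenerate A Q G n x}"
    using degenerate_eqpoll[OF G.polyadic_set_axioms wf n] .
  finally have "FObj F n - {x \<in> FObj F n. degenerate A Q F n x}
      \<approx> FObj G n - {x \<in> FObj G n. degenerate A Q G n x}"
    by (intro eqpoll_Diff_finite[OF FG F.finite_FObj[OF n]]) auto
  then show ?thesis
    by (simp add: stirling_kernel_def set_diff_eq cong: conj_cong)
qed

end

theorem proposition3p15:
  fixes A :: "('o, 'm) cat" and Q M :: "'m set" and U :: "'u set"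
    and F :: "('o, 'm, 'x) set_functor" and G :: "('o, 'm, 'y) set_functor"
  assumes "proper_factorisation_system A Q M"
    and "locally_small U A" and "well_powered U A" and "well_copowered U A"
    and "quotient_well_founded A Q"
    and "polyadic_finite_set A F" and "polyadic_finite_set A G"
    and "pointwise_isomorphic A F G"
  shows "pointwise_isomorphic (embedding_category A M)
           (stirling_kernel A Q F) (stirling_kernel A Q G)"
proof -
  interpret proper_factorisation_system A Q M by fact
  let ?P = "\<lambda>n. FObj (stirling_kernel A Q F) n \<approx> FObj (stirling_kernel A Q G) n"
  have step: "?P n"
    if n: "n \<in> Obj A" and "\<And>q. proper_quotient A Q q \<Longrightarrow> Dom A q = n \<Longrightarrow> ?P (Cod A q)" for n
    using generic_eqpoll_step[OF assms(6,7,5) n] assms(8) n that(2)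
    unfolding pointwise_isomorphic_def by blast
  have "?P n" if n: "n \<in> Obj A" for n
  proof (rule ccontr)
    assume "\<not> ?P n"
    \<comment> \<open>Well-foundedness concerns quotients of one fixed object, so the descent runs
      through codomains of quotients of \<open>n\<close>, starting from the identity.\<close>
    then have "\<not> ?P (Cod A (Ide A n))"
      using homD[OF Ide_in_hom[OF n]] by simp
    then obtain q where q: "q \<in> Q" "\<not> ?P (Cod A q)"
        "\<And>p m. proper_quotient A Q p \<Longrightarrow> p \<in> hom A (Cod A q) m \<Longrightarrow> ?P (Cod A (p \<cdot>\<^bsub>A\<^esub> q))"
      using minimal_quotient[OF assms(5) Ide_in_Q[OF n], of "\<lambda>q. \<not> ?P (Cod A q)"] by metis
    \<comment> \<open>Codomains of proper quotients of \<open>Cod A q\<close> are also codomains of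
      quotients of \<open>n\<close>, so minimality of \<open>q\<close> supplies the induction
      hypothesis at \<open>Cod A q\<close>.\<close>
    have "?P (Cod A p)" if p: "proper_quotient A Q p" "Dom A p = Cod A q" for p
    proof -
      have ph: "p \<in> hom A (Cod A q) (Cod A p)"
        using homI[of p A] p Q_arr by (simp add: proper_quotient_def)
      then show ?thesis
        using q(3)[OF p(1) ph] homD[OF Comp_in_hom[OF homI[OF Q_arr[OF q(1)]] ph]] by simp
    qed
    then show False
      using step[of "Cod A q"] q(1,2) Q_arr Cod_in_Obj by blast
  qed
  then show ?thesis
    by (simp add: pointwise_isomorphic_def embedding_category_def)
qed

end
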